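(* Let $D\ge 1$ be an integer and let $a_1,\dots,a_D,c_1,\dots,c_D$ be fixed positive real constants with $a_d\neq c_d$ for every $d\in\{1,\dots,D\}$ and $\sum_{d=1}^D (a_d+c_d)\le 1$. Then there is a constant $c_0\in(0,1)$, independent of the lattice size (that is, of $N_1,\dots,N_D$ and $N=N_1N_2\cdots N_D$), such that for every $N_1\times N_2\times\cdots\times N_D$ lattice, with $W^{(D)}$ the stochastic matrix compatible with the lattice whose weights are $W^{(D)}_{i,i^{d+}}=c_d$ and $W^{(D)}_{i,i^{d-}}=a_d$ ($d=1,\dots,D$), the convergence rate $R=1-\rho(W^{(D)})$ satisfies $$R\ \ge\ c_0 .$$
   Context: An $N_1\times\cdots\times N_D$ ($D$-dimensional) lattice is the graph with $N=N_1N_2\cdots N_D$ nodes placed at the integer points of a box with side lengths $N_1,\dots,N_D$ (in nodes) in $\mathbb{R}^D$ with Cartesian axes $x_1,\dots,x_D$, where each node is connected (in both directions) to exactly the nodes at distance one from it. Here $N\ge 2$. For a node $i$, $i^{d+}$ (resp. $i^{d-}$) denotes its neighbor in the positive (resp. negative) $x_d$ direction, when that neighbor exists. The weight matrix $W^{(D)}$ is the $N\times N$ matrix indexed by nodes with the prescribed off-diagonal entries $W_{i,i^{d+}}=c_d$ and $W_{i,i^{d-}}=a_d$ for existing neighbors, all other off-diagonal entries equal to $0$, and diagonal entries $W_{i,i}=1-\sum_{j\ne i}W_{i,j}$, so that $W$ is (row) stochastic: entries nonnegative and $W\mathbf 1=\mathbf 1$, with $\mathbf 1$ the all-ones vector.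 The essential spectral radius is $\rho(W)=\max\{|\lambda| : \lambda\in\sigma(W)\setminus\{1\}\}$, where $\sigma(W)$ is the spectrum of $W$, and the convergence rate is $R=1-\rho(W)$. *)

theory Defs
  imports "Jordan_Normal_Form.Spectral_Radius"
begin

(* A node of the box with side lengths Ns is the list of its coordinates, counted
   from 0; axis d (counted from 0) is list position d. *)

definition lattice_nodes :: "nat list \<Rightarrow> nat list list" where
  "lattice_nodes Ns = product_lists (map (\<lambda>n. [0..<n]) Ns)"

definition pos_neighbor :: "nat \<Rightarrow> nat list \<Rightarrow> nat list" where
  "pos_neighbor d i = i[d := Suc (i ! d)]"

(* Two distinct nodes are neighbors along at most one axis and in at most one direction,
   so the sum has at most one nonzero term; "j is the negative neighbor of i" is expressed
   as "i is the positive neighbor of j". *)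
definition offdiag_weight :: "(nat \<Rightarrow> real) \<Rightarrow> (nat \<Rightarrow> real) \<Rightarrow> nat list \<Rightarrow> nat list \<Rightarrow> real" where
  "offdiag_weight a c i j =
     (\<Sum>d<length i. (if j = pos_neighbor d i then c d else 0) +
                      (if i = pos_neighbor d j then a d else 0))"

definition lattice_entry ::
    "(nat \<Rightarrow> real) \<Rightarrow> (nat \<Rightarrow> real) \<Rightarrow> nat list \<Rightarrow> nat list \<Rightarrow> nat list \<Rightarrow> real" where
  "lattice_entry a c Ns i j =
     (if i = j then 1 - (\<Sum>k\<in>set (lattice_nodes Ns) - {i}. offdiag_weight a c i k)
      else offdiag_weight a c i j)"

(* Rows and columns are numbered along the enumeration lattice_nodes Ns; the spectrum
   does not depend on the choice of enumeration. *)
definition lattice_matrix :: "(nat \<Rightarrow> real) \<Rightarrow> (nat \<Rightarrow> real) \<Rightarrow> nat list \<Rightarrow> real mat" where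
  "lattice_matrix a c Ns =
     mat (prod_list Ns) (prod_list Ns)
       (\<lambda>(r, s). lattice_entry a c Ns (lattice_nodes Ns ! r) (lattice_nodes Ns ! s))"

definition stochastic_mat :: "real mat \<Rightarrow> bool" where
  "stochastic_mat W \<longleftrightarrow>
     square_mat W \<and>
     (\<forall>r<dim_row W. \<forall>s<dim_col W. 0 \<le> W $$ (r, s)) \<and>
     W *\<^sub>v vec (dim_col W) (\<lambda>_. 1) = vec (dim_row W) (\<lambda>_. 1)"

(* The spectrum is taken over the complex numbers. *)
definition essential_spectral_radius :: "real mat \<Rightarrow> real" where
  "essential_spectral_radius W = Max (norm ` (spectrum (map_mat complex_of_real W) - {1}))"

definition convergence_rate :: "real mat \<Rightarrow> real" where
  "convergence_rate W = 1 - essential_spectral_radius W"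


lemma set_lattice_nodes:
  "set (lattice_nodes Ns) = {i. length i = length Ns \<and> (\<forall>d<length Ns. i ! d < Ns ! d)}"
  by (auto simp: lattice_nodes_def product_lists_set list_all2_conv_all_nth)

lemma length_lattice_nodes: "length (lattice_nodes Ns) = prod_list Ns"
proof -
  have "length (product_lists xss) = prod_list (map length xss)" for xss :: "nat list list"
    by (induction xss) (auto simp: length_concat comp_def sum_list_triv)
  then show ?thesis
    by (simp add: lattice_nodes_def comp_def)
qed

lemma distinct_lattice_nodes: "distinct (lattice_nodes Ns)"
  unfolding lattice_nodes_def by (rule distinct_product_lists) auto

lemma pos_neighbor_inj:
  assumes "d < length j" "pos_neighbor d j = pos_neighbor d k"
  shows "j = k"
proof (rule nth_equalityI)
  show len: "length j = length k"
    using arg_cong[OF assms(2), of length] by (simp add: pos_neighbor_def)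
  fix e assume "e < length j"
  then show "j ! e = k ! e"
    using arg_cong[OF assms(2), of "\<lambda>l. l ! e"] len
    by (cases "e = d") (auto simp: pos_neighbor_def)
qed

lemma neighbor_iff_distance_one:
  assumes len: "length j = length i"
  shows "(\<exists>d<length i. j = pos_neighbor d i \<or> i = pos_neighbor d j) \<longleftrightarrow>
         sqrt (\<Sum>d<length i. (real (i ! d) - real (j ! d))\<^sup>2) = 1"
    (is "?L \<longleftrightarrow> ?R")
proof
  assume ?L
  then obtain d where d: "d < length i" "j = pos_neighbor d i \<or> i = pos_neighbor d j"
    by blast
  have "(real (i ! e) - real (j ! e))\<^sup>2 = (if e = d then 1 else 0)" if "e < length i" for e
  proof (cases "j = pos_neighbor d i")
    case True
    then show ?thesis
      using d(1) that by (auto simp: pos_neighbor_def)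
  next
    case False
    with d have "i = pos_neighbor d j"
      by blast
    then have "i ! e = pos_neighbor d j ! e"
      by simp
    also have "\<dots> = (if e = d then Suc (j ! e) else j ! e)"
      using that len by (auto simp: pos_neighbor_def)
    finally show ?thesis
      by simp
  qed
  then have "(\<Sum>e<length i. (real (i ! e) - real (j ! e))\<^sup>2) =
      (\<Sum>e<length i. if e = d then 1 else 0)"
    by (intro sum.cong) auto
  then show ?R
    using d(1) by simp
next
  assume ?R
  let ?f = "\<lambda>d. (int (i ! d) - int (j ! d))\<^sup>2"
  have "real_of_int (\<Sum>d<length i. ?f d) = 1"
    using \<open>?R\<close> by simp
  then have sum1: "(\<Sum>d<length i. ?f d) = 1"
    by linarith
  then obtain d where d: "d < length i" "?f d \<noteq> 0"
    by (metis (no_types, lifting) lessThan_iff sum.neutral zero_neq_one)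
  have split: "?f d + (\<Sum>e\<in>{..<length i} - {d}. ?f e) = 1"
    using sum1 d(1) by (simp add: sum.remove[of _ d])
  have nonneg: "0 \<le> (\<Sum>e\<in>{..<length i} - {d}. ?f e)"
    by (intro sum_nonneg) auto
  have "1 \<le> ?f d"
    using d(2) zero_le_power2[of "int (i ! d) - int (j ! d)"] by linarith
  with split nonneg have fd: "?f d = 1" and rest: "(\<Sum>e\<in>{..<length i} - {d}. ?f e) = 0"
    by linarith+
  have eq: "i ! e = j ! e" if "e < length i" "e \<noteq> d" for e
    using rest that by (auto simp: sum_nonneg_eq_0_iff)
  from fd have "j ! d = Suc (i ! d) \<or> i ! d = Suc (j ! d)"
    by (auto simp: power2_eq_1_iff)
  then have "j = pos_neighbor d i \<or> i = pos_neighbor d j"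
  proof
    assume "j ! d = Suc (i ! d)"
    then have "j = pos_neighbor d i"
      using eq len d(1) by (intro nth_equalityI) (auto simp: pos_neighbor_def nth_list_update)
    then show ?thesis ..
  next
    assume "i ! d = Suc (j ! d)"
    then have "i = pos_neighbor d j"
      using eq len d(1)
      by (intro nth_equalityI) (auto simp: pos_neighbor_def nth_list_update split: if_splits)
    then show ?thesis ..
  qed
  with d(1) show ?L
    by blast
qed

lemma offdiag_weight_pos_neighbor:
  assumes "d < length i"
  shows "offdiag_weight a c i (pos_neighbor d i) = c d"
    and "offdiag_weight a c (pos_neighbor d i) i = a d"
proof -
  have 1: "pos_neighbor d i = pos_neighbor e i \<longleftrightarrow> e = d" if "e < length i" for e
  proof
    assume "pos_neighbor d i = pos_neighbor e i"
    then have "pos_neighbor d i ! d = pos_neighbor e i ! d"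
      by simp
    then show "e = d"
      using assms by (cases "e = d") (auto simp: pos_neighbor_def)
  qed simp
  have 2: "i \<noteq> pos_neighbor e (pos_neighbor d i)" if "e < length i" for e
  proof
    assume "i = pos_neighbor e (pos_neighbor d i)"
    then have "i ! d = pos_neighbor e (pos_neighbor d i) ! d"
      by simp
    then show False
      using assms that by (auto simp: pos_neighbor_def nth_list_update split: if_splits)
  qed
  show "offdiag_weight a c i (pos_neighbor d i) = c d"
    unfolding offdiag_weight_def using assms by (simp add: 1 2 sum.delta cong: sum.cong_simp)
  have l: "length (pos_neighbor d i) = length i"
    by (simp add: pos_neighbor_def)
  show "offdiag_weight a c (pos_neighbor d i) i = a d"
    unfolding offdiag_weight_def l using assms by (simp add: 1 2 sum.delta cong: sum.cong_simp)
qed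

lemma stochastic_lattice_matrix:
  fixes a c :: "nat \<Rightarrow> real"
  assumes "\<And>d. d < length Ns \<Longrightarrow> 0 \<le> a d" "\<And>d. d < length Ns \<Longrightarrow> 0 \<le> c d"
    and le: "(\<Sum>d<length Ns. a d + c d) \<le> 1"
  shows "stochastic_mat (lattice_matrix a c Ns)"
proof -
  let ?V = "set (lattice_nodes Ns)"
  let ?W = "lattice_matrix a c Ns"
  let ?n = "prod_list Ns"
  have off_nonneg: "0 \<le> offdiag_weight a c i j" if "i \<in> ?V" for i j
    using that assms(1,2)
    by (auto simp: offdiag_weight_def set_lattice_nodes intro!: sum_nonneg add_nonneg_nonneg)
  have diag: "(\<Sum>k\<in>?V - {i}. offdiag_weight a c i k) \<le> 1" if i: "i \<in> ?V" for i
  proof -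
    have len: "length i = length Ns"
      using i by (simp add: set_lattice_nodes)
    let ?A = "?V - {i}"
    have "(\<Sum>k\<in>?A. offdiag_weight a c i k) =
        (\<Sum>d<length Ns. (\<Sum>k\<in>?A. if k = pos_neighbor d i then c d else 0) +
                         (\<Sum>k\<in>?A. if i = pos_neighbor d k then a d else 0))"
      unfolding offdiag_weight_def len by (subst sum.swap) (simp add: sum.distrib)
    also have "\<dots> \<le> (\<Sum>d<length Ns. c d + a d)"
    proof (intro sum_mono add_mono)
      fix d assume "d \<in> {..<length Ns}"
      then have d: "d < length Ns" by simp
      show "(\<Sum>k\<in>?A. if k = pos_neighbor d i then c d else 0) \<le> c d"
        using assms(2)[OF d] by (simp add: sum.delta)
      show "(\<Sum>k\<in>?A. if i = pos_neighbor d k then a d else 0) \<le> a d"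
      proof (cases "\<exists>j\<in>?A. i = pos_neighbor d j")
        case True
        then obtain j where j: "j \<in> ?A" "i = pos_neighbor d j" by blast
        have "(i = pos_neighbor d k) = (k = j)" if "k \<in> ?A" for k
          using pos_neighbor_inj[of d j k] j that d by (auto simp: set_lattice_nodes)
        then have "(\<Sum>k\<in>?A. if i = pos_neighbor d k then a d else 0) =
            (\<Sum>k\<in>?A. if k = j then a d else 0)"
          by (intro sum.cong) auto
        then show ?thesis
          using j by (simp add: sum.delta)
      next
        case False
        then have "(\<Sum>k\<in>?A. if i = pos_neighbor d k then a d else 0) = 0"
          by (intro sum.neutral) auto
        then show ?thesis
          using assms(1)[OF d] by simp
      qed
    qed
    also have "\<dots> \<le> 1"
      using le by (simp add: add.commute)
    finally show ?thesis .
  qed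
  have node: "lattice_nodes Ns ! r \<in> ?V" if "r < ?n" for r
    using that by (simp add: length_lattice_nodes)
  have nonneg: "0 \<le> ?W $$ (r, s)" if "r < ?n" "s < ?n" for r s
    using that off_nonneg[OF node] diag[OF node]
    by (simp add: lattice_matrix_def lattice_entry_def)
  have row: "(\<Sum>s<?n. ?W $$ (r, s)) = 1" if r: "r < ?n" for r
  proof -
    let ?i = "lattice_nodes Ns ! r"
    have bij: "bij_betw ((!) (lattice_nodes Ns)) {..<?n} ?V"
      by (rule bij_betw_nth) (auto simp: distinct_lattice_nodes length_lattice_nodes)
    have "(\<Sum>s<?n. ?W $$ (r, s)) = (\<Sum>s<?n. lattice_entry a c Ns ?i (lattice_nodes Ns ! s))"
      using r by (simp add: lattice_matrix_def)
    also have "\<dots> = (\<Sum>k\<in>?V. lattice_entry a c Ns ?i k)"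
      by (rule sum.reindex_bij_betw[OF bij])
    also have "\<dots> = lattice_entry a c Ns ?i ?i + (\<Sum>k\<in>?V - {?i}. lattice_entry a c Ns ?i k)"
      by (rule sum.remove) (use node[OF r] in auto)
    also have "(\<Sum>k\<in>?V - {?i}. lattice_entry a c Ns ?i k) =
        (\<Sum>k\<in>?V - {?i}. offdiag_weight a c ?i k)"
      by (rule sum.cong) (auto simp: lattice_entry_def)
    finally show ?thesis
      by (simp add: lattice_entry_def)
  qed
  have dims: "dim_row ?W = ?n" "dim_col ?W = ?n"
    by (simp_all add: lattice_matrix_def)
  have "?W *\<^sub>v vec ?n (\<lambda>_. 1) = vec ?n (\<lambda>_. 1)"
    using row by (intro eq_vecI) (auto simp: dims scalar_prod_def lessThan_atLeast0)
  with nonneg show ?thesis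
    by (simp add: stochastic_mat_def dims)
qed

end

theory Submission
  imports Defs
begin

text \<open>
  Write \<open>W = I + L\<^sub>0 + \<dots> + L\<^sub>D\<^sub>-\<^sub>1\<close>, where \<open>L\<^sub>d\<close> moves along axis \<open>d\<close> only: it is the generator
  of a reflected birth-death chain with rate \<open>c d\<close> upwards and \<open>a d\<close> downwards. The bound
  obtained is \<open>R \<ge> min\<^sub>d (\<surd>a d - \<surd>c d)\<^sup>2\<close>, which does not see the side lengths.

  Let \<open>W F = z F\<close> with \<open>z \<noteq> 1\<close>. Then \<open>F\<close> is not constant, so along some axis \<open>d\<close> its increments
  \<open>u i = F (i + e\<^sub>d) - F i\<close> do not all vanish. Taking increments turns the reflecting ends of
  \<open>L\<^sub>d\<close> into absorbing ones: \<open>u\<close> satisfies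
  \<open>z u(p) = u(p) + c d u(p + e\<^sub>d) - (a d + c d) u(p) + a d u(p - e\<^sub>d) + \<Sum>\<^sub>e\<^sub>\<noteq>\<^sub>d (L\<^sub>e u)(p)\<close>,
  with \<open>u = 0\<close> beyond the two ends. The constants are gone, and with them the eigenvalue 1.
  Rescaling \<open>u\<close> by powers of \<open>\<surd>(c d / a d)\<close> gives both neighbours along axis \<open>d\<close> the weight
  \<open>\<surd>(a d * c d)\<close>. At a node where the rescaled \<open>u\<close> has the greatest modulus, the axes \<open>e \<noteq> d\<close>
  contribute at most what they take from the diagonal, while axis \<open>d\<close> takes \<open>a d + c d\<close> and gives
  back at most \<open>2 \<surd>(a d * c d)\<close>. Since the diagonal stays nonnegative,
  \<open>|z| \<le> 1 - (a d + c d) + 2 \<surd>(a d * c d) = 1 - (\<surd>a d - \<surd>c d)\<^sup>2\<close>; this is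
  \<open>eigenvalue_bound_if_increment\<close>.

  The essential spectral radius is a maximum over \<open>\<sigma>(W) - {1}\<close>, so this set must also be shown
  to be nonempty: an axis of length at least 2 carries an explicit sine eigenfunction with
  another eigenvalue (\<open>ex_eigenvalue_lattice_matrix_neq_1\<close>).
\<close>

section \<open>The lattice matrix as a sum of one-axis generators\<close>

text \<open>
  The operator \<open>L\<^sub>d\<close>, acting on functions of the nodes. The two conditions express that a missing
  neighbour contributes nothing, that is, reflection at the ends of the box.
\<close>
definition axis_generator ::
    "(nat \<Rightarrow> real) \<Rightarrow> (nat \<Rightarrow> real) \<Rightarrow> nat list \<Rightarrow> nat \<Rightarrow> (nat list \<Rightarrow> complex) \<Rightarrow> nat list \<Rightarrow> complex" where
  "axis_generator a c Ns d F i =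
     (if Suc (i ! d) < Ns ! d then of_real (c d) * (F (i[d := Suc (i ! d)]) - F i) else 0) +
     (if 0 < i ! d then of_real (a d) * (F (i[d := i ! d - 1]) - F i) else 0)"

lemma lattice_nodes_list_update:
  assumes "i \<in> set (lattice_nodes Ns)" "k < Ns ! d"
  shows "i[d := k] \<in> set (lattice_nodes Ns)"
  unfolding set_lattice_nodes
proof (intro CollectI conjI allI impI)
  fix e assume "e < length Ns"
  then show "i[d := k] ! e < Ns ! e"
    using assms by (cases "e = d") (auto simp: set_lattice_nodes)
qed (use assms in \<open>simp add: set_lattice_nodes\<close>)

lemma pos_neighbor_in_lattice_nodes_iff:
  assumes "i \<in> set (lattice_nodes Ns)" "d < length Ns"
  shows "pos_neighbor d i \<in> set (lattice_nodes Ns) \<longleftrightarrow> Suc (i ! d) < Ns ! d"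
  using assms by (auto simp: set_lattice_nodes pos_neighbor_def nth_list_update)

lemma eq_pos_neighbor_iff:
  assumes "length k = length i" "d < length i"
  shows "i = pos_neighbor d k \<longleftrightarrow> 0 < i ! d \<and> k = i[d := i ! d - 1]"
proof
  assume i: "i = pos_neighbor d k"
  have "i ! d = Suc (k ! d)"
    by (subst i) (use assms in \<open>simp add: pos_neighbor_def\<close>)
  moreover have "i[d := k ! d] = k"
    by (subst i) (simp add: pos_neighbor_def)
  ultimately show "0 < i ! d \<and> k = i[d := i ! d - 1]" by simp
next
  assume k: "0 < i ! d \<and> k = i[d := i ! d - 1]"
  then show "i = pos_neighbor d k"
    using assms(2) by (simp add: pos_neighbor_def)
qed

text \<open>
  Since the rows of \<open>W\<close> sum to 1, the diagonal entry can be absorbed: only differences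
  \<open>F k - F i\<close> over the neighbours \<open>k\<close> of \<open>i\<close> remain, and these group by axis.
\<close>
lemma lattice_row_sum:
  fixes F :: "nat list \<Rightarrow> complex"
  assumes i: "i \<in> set (lattice_nodes Ns)"
  shows "(\<Sum>k\<in>set (lattice_nodes Ns). of_real (lattice_entry a c Ns i k) * F k) =
         F i + (\<Sum>d<length Ns. axis_generator a c Ns d F i)"
proof -
  let ?V = "set (lattice_nodes Ns)"
  have len: "length i = length Ns" using i by (simp add: set_lattice_nodes)
  have "(\<Sum>k\<in>?V. of_real (lattice_entry a c Ns i k) * F k) =
      of_real (lattice_entry a c Ns i i) * F i +
      (\<Sum>k\<in>?V-{i}. of_real (offdiag_weight a c i k) * F k)"
    by (subst sum.remove[OF _ i])
      (auto simp: lattice_entry_def split: if_splits intro!: sum.cong)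
  also have "\<dots> = F i + (\<Sum>k\<in>?V-{i}. of_real (offdiag_weight a c i k) * (F k - F i))"
    by (simp add: lattice_entry_def algebra_simps sum_subtractf sum_distrib_left)
  also have "(\<Sum>k\<in>?V-{i}. of_real (offdiag_weight a c i k) * (F k - F i)) =
      (\<Sum>k\<in>?V. of_real (offdiag_weight a c i k) * (F k - F i))"
    by (intro sum.mono_neutral_left) auto
  also have "\<dots> = (\<Sum>d<length Ns.
      (\<Sum>k\<in>?V. if k = pos_neighbor d i then of_real (c d) * (F k - F i) else 0) +
      (\<Sum>k\<in>?V. if i = pos_neighbor d k then of_real (a d) * (F k - F i) else 0))"
  proof -
    have "of_real (offdiag_weight a c i k) * (F k - F i) = (\<Sum>d<length Ns.
        (if k = pos_neighbor d i then of_real (c d) * (F k - F i) else 0) +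
        (if i = pos_neighbor d k then of_real (a d) * (F k - F i) else 0))" for k
      unfolding offdiag_weight_def len of_real_sum sum_distrib_right
      by (rule sum.cong) (simp_all add: distrib_right)
    then show ?thesis
      by (simp only: sum.distrib[symmetric] sum.swap[of _ "{..<length Ns}"])
  qed
  also have "\<dots> = (\<Sum>d<length Ns. axis_generator a c Ns d F i)"
  proof (intro sum.cong refl)
    fix d assume "d \<in> {..<length Ns}"
    then have d: "d < length Ns" by simp
    have up: "(\<Sum>k\<in>?V. if k = pos_neighbor d i then of_real (c d) * (F k - F i) else 0) =
        (if Suc (i ! d) < Ns ! d then of_real (c d) * (F (i[d := Suc (i ! d)]) - F i) else 0)"
      by (simp add: sum.delta pos_neighbor_in_lattice_nodes_iff[OF i d])
        (simp add: pos_neighbor_def)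
    have "(\<Sum>k\<in>?V. if i = pos_neighbor d k then of_real (a d) * (F k - F i) else 0) =
        (\<Sum>k\<in>?V. if k = i[d := i ! d - 1]
           then (if 0 < i ! d then of_real (a d) * (F k - F i) else 0) else 0)"
      using d len by (intro sum.cong) (auto simp: eq_pos_neighbor_iff set_lattice_nodes)
    also have "\<dots> = (if 0 < i ! d then of_real (a d) * (F (i[d := i ! d - 1]) - F i) else 0)"
    proof -
      have "i ! d - 1 < Ns ! d" using i d by (auto simp: set_lattice_nodes less_imp_diff_less)
      with i show ?thesis by (simp add: lattice_nodes_list_update)
    qed
    finally show "(\<Sum>k\<in>?V. if k = pos_neighbor d i then of_real (c d) * (F k - F i) else 0) +
        (\<Sum>k\<in>?V. if i = pos_neighbor d k then of_real (a d) * (F k - F i) else 0) =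
        axis_generator a c Ns d F i"
      unfolding up axis_generator_def by simp
  qed
  finally show ?thesis .
qed

text \<open>
  Eigenvectors are turned into functions on the box, where increments along an axis make sense.
\<close>
lemma eigenvalue_lattice_matrix_iff:
  "eigenvalue (map_mat complex_of_real (lattice_matrix a c Ns)) z \<longleftrightarrow>
     (\<exists>F. (\<exists>i\<in>set (lattice_nodes Ns). F i \<noteq> 0) \<and>
          (\<forall>i\<in>set (lattice_nodes Ns).
             F i + (\<Sum>d<length Ns. axis_generator a c Ns d F i) = z * F i))"
proof -
  let ?V = "set (lattice_nodes Ns)"
  let ?n = "prod_list Ns"
  let ?x = "\<lambda>r. lattice_nodes Ns ! r"
  let ?W = "map_mat complex_of_real (lattice_matrix a c Ns)"
  have bij: "bij_betw ?x {..<?n} ?V"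
    by (rule bij_betw_nth) (auto simp: distinct_lattice_nodes length_lattice_nodes)
  have node: "?x r \<in> ?V" if "r < ?n" for r
    using that by (simp add: length_lattice_nodes)
  have dims: "dim_row ?W = ?n" "dim_col ?W = ?n"
    by (simp_all add: lattice_matrix_def)
  have act: "(?W *\<^sub>v vec ?n (\<lambda>r. F (?x r))) $ r =
      F (?x r) + (\<Sum>d<length Ns. axis_generator a c Ns d F (?x r))" if r: "r < ?n" for r F
  proof -
    have "(?W *\<^sub>v vec ?n (\<lambda>r. F (?x r))) $ r =
        (\<Sum>s<?n. of_real (lattice_entry a c Ns (?x r) (?x s)) * F (?x s))"
      using r by (simp add: scalar_prod_def lessThan_atLeast0 lattice_matrix_def)
    also have "\<dots> = (\<Sum>k\<in>?V. of_real (lattice_entry a c Ns (?x r) k) * F k)"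
      by (rule sum.reindex_bij_betw[OF bij])
    finally show ?thesis using lattice_row_sum[OF node[OF r]] by simp
  qed
  show ?thesis
  proof
    assume "eigenvalue ?W z"
    then obtain v where v: "v \<in> carrier_vec ?n" "v \<noteq> 0\<^sub>v ?n" "?W *\<^sub>v v = z \<cdot>\<^sub>v v"
      unfolding eigenvalue_def eigenvector_def dims by blast
    define F where "F = (\<lambda>i. v $ inv_into {..<?n} ?x i)"
    have F: "F (?x r) = v $ r" if "r < ?n" for r
      using that bij_betw_imp_inj_on[OF bij] by (simp add: F_def inv_into_f_f)
    have vF: "v = vec ?n (\<lambda>r. F (?x r))"
      using v(1) F by (intro eq_vecI) auto
    obtain r where "r < ?n" "v $ r \<noteq> 0"
      using v(1,2) by (metis carrier_vecD eq_vecI index_zero_vec(1) index_zero_vec(2))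
    then have "\<exists>i\<in>?V. F i \<noteq> 0" using F node by metis
    moreover have "F i + (\<Sum>d<length Ns. axis_generator a c Ns d F i) = z * F i" if i: "i \<in> ?V" for i
    proof -
      obtain r where r: "r < ?n" "i = ?x r"
        using i unfolding in_set_conv_nth length_lattice_nodes by blast
      show ?thesis using act[OF r(1), of F] v(1,3) r F[OF r(1)] unfolding vF[symmetric] by simp
    qed
    ultimately show "\<exists>F. (\<exists>i\<in>?V. F i \<noteq> 0) \<and>
        (\<forall>i\<in>?V. F i + (\<Sum>d<length Ns. axis_generator a c Ns d F i) = z * F i)" by blast
  next
    assume "\<exists>F. (\<exists>i\<in>?V. F i \<noteq> 0) \<and>
        (\<forall>i\<in>?V. F i + (\<Sum>d<length Ns. axis_generator a c Ns d F i) = z * F i)"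
    then obtain F i where i: "i \<in> ?V" "F i \<noteq> 0"
      and F: "\<forall>i\<in>?V. F i + (\<Sum>d<length Ns. axis_generator a c Ns d F i) = z * F i" by blast
    let ?v = "vec ?n (\<lambda>r. F (?x r))"
    obtain r where r: "r < ?n" "i = ?x r"
      using i(1) unfolding in_set_conv_nth length_lattice_nodes by blast
    then have "?v $ r \<noteq> 0\<^sub>v ?n $ r" using i by simp
    then have "?v \<noteq> 0\<^sub>v ?n" by metis
    moreover have "?W *\<^sub>v ?v = z \<cdot>\<^sub>v ?v"
    proof (rule eq_vecI)
      fix r assume "r < dim_vec (z \<cdot>\<^sub>v ?v)"
      then have r: "r < ?n" by simp
      show "(?W *\<^sub>v ?v) $ r = (z \<cdot>\<^sub>v ?v) $ r"
        using act[OF r] F node[OF r] r by simp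
    qed (simp add: lattice_matrix_def)
    ultimately show "eigenvalue ?W z"
      unfolding eigenvalue_def eigenvector_def dims by (intro exI[of _ ?v]) auto
  qed
qed

section \<open>Eigenvalues other than 1 lie in a smaller disc\<close>

text \<open>
  Every node is joined to the corner \<open>(0, \<dots>, 0)\<close> by steps that lower one coordinate, so the
  induction is on the coordinate sum.
\<close>
lemma lattice_constant_if_no_increment:
  fixes F :: "nat list \<Rightarrow> complex"
  assumes "\<And>i d. i \<in> set (lattice_nodes Ns) \<Longrightarrow> d < length Ns \<Longrightarrow> Suc (i ! d) < Ns ! d \<Longrightarrow>
             F (i[d := Suc (i ! d)]) = F i"
    and "i \<in> set (lattice_nodes Ns)"
  shows "F i = F (replicate (length Ns) 0)"
  using assms(2)
proof (induction "sum_list i" arbitrary: i rule: less_induct)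
  case less
  have len: "length i = length Ns" using less.prems by (simp add: set_lattice_nodes)
  show ?case
  proof (cases "\<exists>d<length Ns. 0 < i ! d")
    case False
    then have "i = replicate (length Ns) 0" using len by (intro nth_equalityI) auto
    then show ?thesis by simp
  next
    case True
    then obtain d where d: "d < length Ns" "0 < i ! d" by blast
    let ?j = "i[d := i ! d - 1]"
    have id: "i ! d < Ns ! d" using less.prems d by (auto simp: set_lattice_nodes)
    have j: "?j \<in> set (lattice_nodes Ns)"
      using less.prems id by (intro lattice_nodes_list_update) auto
    have "sum_list ?j < sum_list i"
      using d len elem_le_sum_list[of d i] by (simp add: sum_list_update)
    then have "F ?j = F (replicate (length Ns) 0)" using j by (rule less.hyps)
    moreover have "F (?j[d := Suc (?j ! d)]) = F ?j"
      using assms(1)[OF j d(1)] d id len by simp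
    then have "F i = F ?j" using d len by simp
    ultimately show ?thesis by simp
  qed
qed

text \<open>
  Steps along different axes commute, so in the equation for the increments the axes \<open>e \<noteq> d\<close>
  appear exactly as they do in the equation for \<open>F\<close>.
\<close>
lemma axis_generator_increment_other:
  assumes "e \<noteq> d"
  shows "axis_generator a c Ns e F (p[d := Suc (p ! d)]) - axis_generator a c Ns e F p =
         axis_generator a c Ns e (\<lambda>i. F (i[d := Suc (i ! d)]) - F i) p"
  using assms by (simp add: axis_generator_def list_update_swap[of d e] algebra_simps)

text \<open>
  Along the same axis the diagonal weight of the increments is \<open>a d + c d\<close> at every position, the
  ends included, whereas a missing neighbour still contributes nothing. The rows of this operator
  at the ends therefore have negative sum: it is the chain that is killed at the ends.
\<close>
lemma axis_generator_increment_same: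
  fixes F :: "nat list \<Rightarrow> complex"
  assumes "d < length p" "Suc (p ! d) < Ns ! d"
  defines "u \<equiv> \<lambda>i. F (i[d := Suc (i ! d)]) - F i"
  shows "axis_generator a c Ns d F (p[d := Suc (p ! d)]) - axis_generator a c Ns d F p =
         (if Suc (Suc (p ! d)) < Ns ! d then of_real (c d) * u (p[d := Suc (p ! d)]) else 0) +
         (if 0 < p ! d then of_real (a d) * u (p[d := p ! d - 1]) else 0) -
         of_real (a d + c d) * u p"
  using assms by (simp add: axis_generator_def algebra_simps)

text \<open>
  A Gershgorin estimate for the operator satisfied by the increments, after the diagonal
  rescaling that balances the weights \<open>a d\<close> and \<open>c d\<close>. Without the rescaling the row sums in
  the interior would still be 1 and nothing would be gained.
\<close>
lemma eigenvalue_bound_if_increment: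
  fixes F :: "nat list \<Rightarrow> complex" and a c :: "nat \<Rightarrow> real"
  assumes a: "\<And>e. e < length Ns \<Longrightarrow> 0 < a e" and c: "\<And>e. e < length Ns \<Longrightarrow> 0 < c e"
    and le: "(\<Sum>e<length Ns. a e + c e) \<le> 1"
    and F: "\<And>i. i \<in> set (lattice_nodes Ns) \<Longrightarrow>
              F i + (\<Sum>e<length Ns. axis_generator a c Ns e F i) = z * F i"
    and d: "d < length Ns"
    and q: "q \<in> set (lattice_nodes Ns)" "Suc (q ! d) < Ns ! d" "F (q[d := Suc (q ! d)]) \<noteq> F q"
  shows "norm z \<le> 1 - (sqrt (a d) - sqrt (c d))\<^sup>2"
proof -
  let ?V = "set (lattice_nodes Ns)"
  define u where "u = (\<lambda>i. F (i[d := Suc (i ! d)]) - F i)"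
  define E where "E = {i \<in> ?V. Suc (i ! d) < Ns ! d}"
  \<comment> \<open>The scaling ratio is the one for which both \<open>c d / t\<close> and \<open>a d * t\<close> equal \<open>s\<close>.\<close>
  define t where "t = sqrt (c d / a d)"
  define s where "s = sqrt (a d * c d)"
  have ad: "0 < a d" and cd: "0 < c d" using a c d by auto
  have t: "0 < t" using ad cd by (simp add: t_def)
  have ct: "c d / t = s" and at: "a d * t = s"
    using ad cd by (simp_all add: t_def s_def real_sqrt_divide real_sqrt_mult field_simps)
  define g where "g = (\<lambda>i. norm (u i) * t ^ (i ! d))"
  have finE: "finite E" and qE: "q \<in> E" using q by (auto simp: E_def)
  obtain p where p: "p \<in> E" and max: "\<And>i. i \<in> E \<Longrightarrow> g i \<le> g p"
  proof -
    have "Max (g ` E) \<in> g ` E" using finE qE by (intro Max_in) auto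
    then obtain p where "p \<in> E" "g p = Max (g ` E)" by auto
    with finE show thesis by (intro that[of p]) auto
  qed
  have pV: "p \<in> ?V" and pd: "Suc (p ! d) < Ns ! d" using p by (auto simp: E_def)
  have lenp: "length p = length Ns" using pV by (simp add: set_lattice_nodes)
  define m where "m = norm (u p)"
  have m: "0 < m"
  proof -
    have "0 < g q" using q t by (simp add: g_def u_def)
    then have "0 < g p" using max[OF qE] by linarith
    then show ?thesis using t by (simp add: g_def m_def zero_less_mult_iff)
  qed
  have same: "norm (u i) \<le> m" if "i \<in> E" "i ! d = p ! d" for i
    using max[OF that(1)] that(2) t by (simp add: g_def m_def)
  have up: "norm (of_real (c d) * u (p[d := Suc (p ! d)])) \<le> s * m"
    if "Suc (Suc (p ! d)) < Ns ! d"
  proof -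
    have "p[d := Suc (p ! d)] \<in> E"
      using that d lenp pV pd by (auto simp: E_def intro!: lattice_nodes_list_update)
    from max[OF this] have "norm (u (p[d := Suc (p ! d)])) * t \<le> m"
      using t d lenp by (simp add: g_def m_def flip: mult.assoc)
    then have "norm (u (p[d := Suc (p ! d)])) \<le> m / t" using t by (simp add: field_simps)
    then have "c d * norm (u (p[d := Suc (p ! d)])) \<le> c d * (m / t)"
      using cd by (intro mult_left_mono) auto
    also have "\<dots> = s * m" by (simp flip: ct)
    finally show ?thesis using cd by (simp add: norm_mult)
  qed
  have down: "norm (of_real (a d) * u (p[d := p ! d - 1])) \<le> s * m" if "0 < p ! d"
  proof -
    have "p[d := p ! d - 1] \<in> E"
      using that d lenp pV pd by (auto simp: E_def intro!: lattice_nodes_list_update)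
    from max[OF this] have "norm (u (p[d := p ! d - 1])) * t ^ (p ! d - 1) \<le> m * t ^ (p ! d)"
      using d lenp by (simp add: g_def m_def)
    also have "m * t ^ (p ! d) = (m * t) * t ^ (p ! d - 1)"
      using that by (simp add: power_eq_if)
    finally have "norm (u (p[d := p ! d - 1])) \<le> m * t" using t by simp
    then have "a d * norm (u (p[d := p ! d - 1])) \<le> a d * (m * t)"
      using ad by (intro mult_left_mono) auto
    also have "\<dots> = s * m" by (simp flip: at)
    finally show ?thesis using ad by (simp add: norm_mult)
  qed
  have s0: "0 \<le> s" using ad cd by (simp add: s_def)
  \<comment> \<open>\<open>k e\<close> is what axis \<open>e\<close> takes from the diagonal weight of the equation for \<open>u p\<close>,
    and \<open>X e\<close> is the off-diagonal part that it contributes.\<close>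
  define k where "k = (\<lambda>e. if e = d then a d + c d else
    (if Suc (p ! e) < Ns ! e then c e else 0) + (if 0 < p ! e then a e else 0))"
  define X where "X = (\<lambda>e. axis_generator a c Ns e F (p[d := Suc (p ! d)]) -
    axis_generator a c Ns e F p + of_real (k e) * u p)"
  have Xd: "norm (X d) \<le> 2 * s * m"
  proof -
    have "X d = (if Suc (Suc (p ! d)) < Ns ! d then of_real (c d) * u (p[d := Suc (p ! d)]) else 0) +
         (if 0 < p ! d then of_real (a d) * u (p[d := p ! d - 1]) else 0)"
      using d lenp pd unfolding X_def u_def
      by (subst axis_generator_increment_same) (auto simp: k_def)
    also have "norm \<dots> \<le> s * m + s * m"
      using up down s0 m by (intro norm_triangle_le add_mono) auto
    finally show ?thesis by (simp add: algebra_simps)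
  qed
  have Xe: "norm (X e) \<le> k e * m" if e: "e < length Ns" "e \<noteq> d" for e
  proof -
    have E1: "norm (u (p[e := j])) \<le> m" if "j < Ns ! e" for j
    proof (rule same)
      show "p[e := j] \<in> E" using that pV pd e
        by (auto simp: E_def intro!: lattice_nodes_list_update)
    qed (use e in simp)
    have pe: "p ! e - 1 < Ns ! e" using pV e by (auto simp: set_lattice_nodes less_imp_diff_less)
    have "X e = (if Suc (p ! e) < Ns ! e then of_real (c e) * u (p[e := Suc (p ! e)]) else 0) +
         (if 0 < p ! e then of_real (a e) * u (p[e := p ! e - 1]) else 0)"
      unfolding X_def axis_generator_increment_other[OF e(2)] u_def[symmetric]
      using e by (simp add: axis_generator_def k_def algebra_simps)
    also have "norm \<dots> \<le> (if Suc (p ! e) < Ns ! e then c e else 0) * m +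
        (if 0 < p ! e then a e else 0) * m"
      using a[OF e(1)] c[OF e(1)] E1 pe
      by (intro norm_triangle_le add_mono) (auto simp: norm_mult)
    finally show ?thesis using e by (simp add: k_def distrib_right)
  qed
  have k1: "(\<Sum>e<length Ns. k e) \<le> 1"
  proof -
    have "(\<Sum>e<length Ns. k e) \<le> (\<Sum>e<length Ns. a e + c e)"
      using a c by (intro sum_mono) (auto simp: k_def intro: less_imp_le add_pos_pos)
    with le show ?thesis by simp
  qed
  have "p[d := Suc (p ! d)] \<in> ?V" using pV pd by (rule lattice_nodes_list_update)
  from F[OF this] F[OF pV]
  have "z * u p = u p + (\<Sum>e<length Ns. axis_generator a c Ns e F (p[d := Suc (p ! d)]) -
    axis_generator a c Ns e F p)"
    unfolding u_def sum_subtractf by (simp add: algebra_simps)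
  also have "\<dots> = of_real (1 - (\<Sum>e<length Ns. k e)) * u p + (\<Sum>e<length Ns. X e)"
    by (simp add: X_def sum.distrib sum_subtractf algebra_simps flip: sum_distrib_left sum_distrib_right)
  finally have eq: "z * u p = \<dots>" .
  have "norm z * m = norm (z * u p)" by (simp add: m_def norm_mult)
  also have "\<dots> \<le> norm (of_real (1 - (\<Sum>e<length Ns. k e)) * u p) + norm (\<Sum>e<length Ns. X e)"
    unfolding eq by (rule norm_triangle_ineq)
  also have "norm (of_real (1 - (\<Sum>e<length Ns. k e)) * u p) = (1 - (\<Sum>e<length Ns. k e)) * m"
    unfolding norm_mult norm_of_real m_def using k1 by simp
  also have "norm (\<Sum>e<length Ns. X e) \<le> (\<Sum>e<length Ns. norm (X e))" by (rule norm_sum)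
  also have "\<dots> = norm (X d) + (\<Sum>e\<in>{..<length Ns} - {d}. norm (X e))"
    using d by (subst sum.remove[of _ d]) auto
  also have "\<dots> \<le> 2 * s * m + (\<Sum>e\<in>{..<length Ns} - {d}. k e * m)"
    using Xd Xe by (intro add_mono sum_mono) auto
  also have "(\<Sum>e\<in>{..<length Ns} - {d}. k e * m) = (\<Sum>e<length Ns. k e) * m - (a d + c d) * m"
    using d by (subst sum.remove[of "{..<length Ns}" d])
      (auto simp: k_def[THEN fun_cong, of d] sum_distrib_left algebra_simps)
  finally have "norm z * m \<le> (1 - (a d + c d) + 2 * s) * m"
    by (simp add: algebra_simps)
  then have "norm z \<le> 1 - (a d + c d) + 2 * s" using m by simp
  also have "\<dots> = 1 - (sqrt (a d) - sqrt (c d))\<^sup>2"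
    using ad cd by (simp add: power2_diff s_def real_sqrt_mult)
  finally show ?thesis .
qed

text \<open>
  If all increments vanished, \<open>F\<close> would be a nonzero constant, which \<open>W\<close> fixes, and \<open>z\<close> would
  be 1.
\<close>
lemma norm_eigenvalue_lattice_matrix_le:
  fixes a c :: "nat \<Rightarrow> real"
  assumes a: "\<And>e. e < length Ns \<Longrightarrow> 0 < a e" and c: "\<And>e. e < length Ns \<Longrightarrow> 0 < c e"
    and le: "(\<Sum>e<length Ns. a e + c e) \<le> 1"
    and ev: "eigenvalue (map_mat complex_of_real (lattice_matrix a c Ns)) z" and z: "z \<noteq> 1"
  shows "\<exists>d<length Ns. norm z \<le> 1 - (sqrt (a d) - sqrt (c d))\<^sup>2"
proof -
  let ?V = "set (lattice_nodes Ns)"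
  obtain F i where i: "i \<in> ?V" "F i \<noteq> 0"
    and F: "\<And>i. i \<in> ?V \<Longrightarrow> F i + (\<Sum>e<length Ns. axis_generator a c Ns e F i) = z * F i"
    using ev unfolding eigenvalue_lattice_matrix_iff by blast
  have "\<exists>q\<in>?V. \<exists>d<length Ns. Suc (q ! d) < Ns ! d \<and> F (q[d := Suc (q ! d)]) \<noteq> F q"
  proof (rule ccontr)
    assume "\<not> ?thesis"
    then have const: "F j = F (replicate (length Ns) 0)" if "j \<in> ?V" for j
      using that by (intro lattice_constant_if_no_increment) auto
    have "axis_generator a c Ns e F i = 0" if e: "e < length Ns" for e
    proof -
      have "i ! e - 1 < Ns ! e" using i e by (auto simp: set_lattice_nodes less_imp_diff_less)
      then show ?thesis
        using const i(1) by (simp add: axis_generator_def lattice_nodes_list_update)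
    qed
    then have "F i = z * F i" using F[OF i(1)] by simp
    with i z show False by simp
  qed
  then show ?thesis
    using eigenvalue_bound_if_increment[of Ns a c F z] a c le F by blast
qed

section \<open>There is an eigenvalue other than 1\<close>

text \<open>
  On a path the generator factors as \<open>B \<Delta>\<close> with \<open>\<Delta> f k = f (k + 1) - f k\<close> and
  \<open>B w k = c * w (k + 1) - a * w k\<close>, where \<open>w k\<close> sits on the edge between \<open>k - 1\<close> and \<open>k\<close> and vanishes
  for \<open>k = 0\<close> and \<open>k = n\<close>. The product in the other order is tridiagonal Toeplitz, with the sine
  eigenvector \<open>w\<close> below, and \<open>f = B w\<close> is an eigenfunction for the same eigenvalue.
\<close>
lemma reflected_path_eigenfunction:
  fixes a c :: real and n :: nat
  assumes a: "0 < a" and c: "0 < c" and ac: "a \<noteq> c" and n: "2 \<le> n"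
  shows "\<exists>f mu. mu < 0 \<and> f 0 \<noteq> 0 \<and>
    (\<forall>k<n. (if Suc k < n then c * (f (Suc k) - f k) else 0) +
           (if 0 < k then a * (f (k - 1) - f k) else 0) = mu * f k)"
proof -
  define th where "th = pi / real n"
  define s where "s = sqrt (a / c)"
  define w where "w = (\<lambda>k. s ^ k * sin (real k * th))"
  define mu where "mu = 2 * sqrt (a * c) * cos th - (a + c)"
  define f where "f = (\<lambda>k. c * w (Suc k) - a * w k)"
  have s: "0 < s" using a c by (simp add: s_def)
  have s2: "c * s\<^sup>2 = a" using a c by (simp add: s_def)
  have sac: "sqrt (a * c) * s = a"
    using a c by (simp add: s_def real_sqrt_mult real_sqrt_divide)
  have w0: "w 0 = 0" and wn: "w n = 0" using n by (simp_all add: w_def th_def)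
  have w_rec: "c * w (Suc (Suc k)) + a * w k = 2 * sqrt (a * c) * cos th * w (Suc k)" for k
  proof -
    let ?x = "real (Suc k) * th"
    have "c * w (Suc (Suc k)) + a * w k =
        (c * s\<^sup>2) * s ^ k * sin (?x + th) + a * s ^ k * sin (?x - th)"
      by (simp add: w_def power2_eq_square algebra_simps)
    also have "\<dots> = 2 * a * s ^ k * sin ?x * cos th"
      unfolding s2 by (simp only: sin_add sin_diff) (simp add: algebra_simps)
    also have "\<dots> = 2 * (sqrt (a * c) * s) * s ^ k * sin ?x * cos th" unfolding sac ..
    finally show ?thesis by (simp add: w_def algebra_simps)
  qed
  have incr: "f (Suc k) - f k = mu * w (Suc k)" for k
    using w_rec[of k] by (simp add: f_def mu_def algebra_simps)
  have "mu < 0"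
  proof -
    have "sqrt (a * c) * cos th \<le> sqrt (a * c) * 1" using a c by (intro mult_left_mono) auto
    moreover have "0 < (sqrt a - sqrt c)\<^sup>2" using ac by simp
    then have "2 * sqrt (a * c) < a + c"
      using a c by (simp add: power2_diff real_sqrt_mult)
    ultimately show ?thesis by (simp add: mu_def)
  qed
  moreover have "f 0 \<noteq> 0"
  proof -
    have "0 < sin th" using n by (intro sin_gt_zero) (auto simp: th_def field_simps)
    then show ?thesis using s c w0 by (simp add: f_def w_def)
  qed
  moreover have "(if Suc k < n then c * (f (Suc k) - f k) else 0) +
           (if 0 < k then a * (f (k - 1) - f k) else 0) = mu * f k" if k: "k < n" for k
  proof -
    have "(if Suc k < n then c * (f (Suc k) - f k) else 0) = c * (mu * w (Suc k))"
    proof (cases "Suc k < n")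
      case False
      then have "Suc k = n" using k by simp
      then show ?thesis using wn by simp
    qed (simp add: incr)
    moreover have "(if 0 < k then a * (f (k - 1) - f k) else 0) = - (a * (mu * w k))"
      using incr[of "k - 1"] w0 by (cases k) (auto simp: algebra_simps)
    ultimately show ?thesis by (simp add: f_def algebra_simps)
  qed
  ultimately show ?thesis by blast
qed

text \<open>
  A function of the \<open>d\<close>-th coordinate alone is annihilated by the generators of all other axes.
\<close>
lemma ex_eigenvalue_lattice_matrix_neq_1:
  fixes a c :: "nat \<Rightarrow> real"
  assumes d: "d < length Ns" and a: "0 < a d" and c: "0 < c d" and ac: "a d \<noteq> c d"
    and n: "2 \<le> Ns ! d" and pos: "\<forall>n\<in>set Ns. 1 \<le> n"
  shows "\<exists>z. z \<noteq> 1 \<and> eigenvalue (map_mat complex_of_real (lattice_matrix a c Ns)) z"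
proof -
  let ?V = "set (lattice_nodes Ns)"
  obtain f mu where mu: "mu < 0" and f0: "f 0 \<noteq> 0"
    and f: "\<forall>k<Ns ! d. (if Suc k < Ns ! d then c d * (f (Suc k) - f k) else 0) +
           (if 0 < k then a d * (f (k - 1) - f k) else 0) = mu * f k"
    using reflected_path_eigenfunction[OF a c ac n] by blast
  define F where "F = (\<lambda>i. complex_of_real (f (i ! d)))"
  have "replicate (length Ns) 0 \<in> ?V"
    using pos by (auto simp: set_lattice_nodes Suc_le_eq)
  moreover have "F (replicate (length Ns) 0) \<noteq> 0" using f0 d by (simp add: F_def)
  moreover have "F i + (\<Sum>e<length Ns. axis_generator a c Ns e F i) = of_real (1 + mu) * F i"
    if i: "i \<in> ?V" for i
  proof -
    have other: "axis_generator a c Ns e F i = 0" if "e \<noteq> d" for e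
      using that by (simp add: axis_generator_def F_def)
    have len: "length i = length Ns" and id: "i ! d < Ns ! d"
      using i d by (auto simp: set_lattice_nodes)
    have "axis_generator a c Ns d F i =
      of_real ((if Suc (i ! d) < Ns ! d then c d * (f (Suc (i ! d)) - f (i ! d)) else 0) +
           (if 0 < i ! d then a d * (f (i ! d - 1) - f (i ! d)) else 0))"
      using d len by (simp add: axis_generator_def F_def)
    also have "\<dots> = of_real mu * F i" using f id by (simp only: F_def) simp
    finally have "axis_generator a c Ns d F i = of_real mu * F i" .
    moreover have "(\<Sum>e<length Ns. axis_generator a c Ns e F i) = axis_generator a c Ns d F i"
      using d other by (subst sum.remove[of _ d]) auto
    ultimately show ?thesis by (simp add: algebra_simps)
  qed
  ultimately have "eigenvalue (map_mat complex_of_real (lattice_matrix a c Ns)) (of_real (1 + mu))"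
    unfolding eigenvalue_lattice_matrix_iff by blast
  moreover have "complex_of_real (1 + mu) \<noteq> 1" using mu by simp
  ultimately show ?thesis by blast
qed

section \<open>The convergence rate\<close>

theorem theorem2:
  fixes D :: nat and a c :: "nat \<Rightarrow> real"
  assumes "D \<ge> 1"
    and "\<And>d. d < D \<Longrightarrow> a d > 0"
    and "\<And>d. d < D \<Longrightarrow> c d > 0"
    and "\<And>d. d < D \<Longrightarrow> a d \<noteq> c d"
    and "(\<Sum>d<D. a d + c d) \<le> 1"
  shows "\<exists>c0::real. 0 < c0 \<and> c0 < 1 \<and>
           (\<forall>Ns :: nat list. length Ns = D \<longrightarrow> (\<forall>n\<in>set Ns. n \<ge> 1) \<longrightarrow> prod_list Ns \<ge> 2 \<longrightarrow>
              convergence_rate (lattice_matrix a c Ns) \<ge> c0)"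
proof -
  let ?gap = "\<lambda>d. (sqrt (a d) - sqrt (c d))\<^sup>2"
  define c0 where "c0 = Min (?gap ` {..<D})"
  have c0_le: "c0 \<le> ?gap d" if "d < D" for d
    using that by (simp add: c0_def)
  have "c0 \<in> ?gap ` {..<D}"
    unfolding c0_def using assms(1) by (intro Min_in) (auto simp: lessThan_empty_iff)
  then obtain d where d: "d < D" "c0 = ?gap d" by blast
  have "0 < c0" using d assms(4) by simp
  moreover have "c0 < 1"
  proof -
    have "0 < sqrt (a d) * sqrt (c d)" using d assms(2,3) by simp
    then have "c0 < a d + c d"
      using d assms(2,3)[OF d(1)] by (simp add: power2_diff)
    also have "\<dots> \<le> (\<Sum>d<D. a d + c d)"
      using d assms(2,3) by (intro member_le_sum) (auto intro: less_imp_le add_pos_pos)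
    finally show ?thesis using assms(5) by simp
  qed
  moreover have "convergence_rate (lattice_matrix a c Ns) \<ge> c0"
    if len: "length Ns = D" and pos: "\<forall>n\<in>set Ns. n \<ge> 1" and n: "prod_list Ns \<ge> 2" for Ns
  proof -
    let ?W = "map_mat complex_of_real (lattice_matrix a c Ns)"
    let ?S = "spectrum ?W - {1}"
    have "\<exists>e<length Ns. 2 \<le> Ns ! e"
    proof (rule ccontr)
      assume "\<not> ?thesis"
      then have "\<forall>n\<in>set Ns. n = 1" using pos by (fastforce simp: in_set_conv_nth)
      then have "prod_list Ns = 1" by (induction Ns) auto
      with n show False by simp
    qed
    then obtain e where e: "e < length Ns" "2 \<le> Ns ! e" by blast
    then have ne: "?S \<noteq> {}"
      using ex_eigenvalue_lattice_matrix_neq_1[of e Ns a c] assms len pos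
      by (auto simp: spectrum_def)
    have "?W \<in> carrier_mat (prod_list Ns) (prod_list Ns)" by (simp add: lattice_matrix_def)
    then have "finite (norm ` ?S)" using card_finite_spectrum(1) by blast
    then have "essential_spectral_radius (lattice_matrix a c Ns) \<in> norm ` ?S"
      unfolding essential_spectral_radius_def using ne by (intro Max_in) auto
    then obtain z where z: "eigenvalue ?W z" "z \<noteq> 1"
      "essential_spectral_radius (lattice_matrix a c Ns) = norm z"
      by (auto simp: spectrum_def)
    then obtain d where "d < D" "norm z \<le> 1 - ?gap d"
      using norm_eigenvalue_lattice_matrix_le[of Ns a c z] assms len by auto
    then show ?thesis using c0_le[of d] z(3) by (simp add: convergence_rate_def)
  qed
  ultimately show ?thesis by blast
qed

end
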